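(* Let $(A,\diamond_A,\alpha)$ be a regular admissible Hom-Poisson algebra ($\alpha$ invertible). Suppose that $(A^*,\diamond_{A^*},(\alpha^{-1})^* )$ is an admissible Hom-Poisson algebra whose product $\diamond_{A^*}$ on the dual space is given by a linear map $\Delta^*:A^*\otimes A^*\to A^*$ (dual to $\Delta:A\to A\otimes A$). Then $(A\oplus A^*,A,A^* )$, with twist $\alpha\oplus(\alpha^{-1})^*$, is a standard Manin triple of admissible Hom-Poisson algebras associated to the bilinear form $B_d(x+a^*,y+b^* )=\langle x,b^*\rangle+\langle y,a^*\rangle$ if and only if $(A,A^*,-R_A^{\star},-L_A^{\star},-R_{A^*}^{\star},-L_{A^*}^{\star},\alpha,(\alpha^{-1})^* )$ is a matched pair of admissible Hom-Poisson algebras.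
   Context: All vector spaces are finite-dimensional over a field $\mathbb F$ in which $3$ is invertible. An admissible Hom-Poisson algebra is a triple $(A,\diamond,\alpha)$ consisting of a vector space $A$, a bilinear operation $\diamond:A\otimes A\to A$ and a linear map $\alpha:A\to A$ with $\alpha(x\diamond y)=\alpha(x)\diamond\alpha(y)$ (multiplicativity, a standing assumption) such that for all $x,y,z\in A$ $$(x\diamond y)\diamond \alpha(z)=\alpha(x)\diamond(y\diamond z)-\tfrac13\big(-\alpha(x)\diamond (z\diamond y)+\alpha(z)\diamond( x\diamond y)+\alpha(y)\diamond (x\diamond z)- \alpha(y)\diamond(z\diamond x)\big).$$ It is regular if $\alpha$ is invertible. A representation of $(A,\diamond,\alpha)$ is a quadruple $(V,\rho,\mu,\beta)$ with $V$ a vector space, $\beta\in\mathrm{End}(V)$ and $\rho,\mu:A\to\mathrm{End}(V)$ linear maps such that for all $x,y\in A$ (juxtaposition is composition): $$\rho(\alpha(x))\beta=\beta\rho(x),\qquad \mu(\alpha(x))\beta=\beta\mu(x),$$ $$\rho(x\diamond y)\beta=\rho(\alpha(x))\rho(y)-\tfrac13\big(-\rho(\alpha(x))\mu(y)+\mu(x\diamond y)\beta+\rho(\alpha(y))\rho(x)-\rho(\alpha(y))\mu(x)\big),$$ $$\mu(\alpha(y))\rho(x)=\rho(\alpha(x))\mu(y)-\tfrac13\big(-\rho(\alpha(x))\rho(y)+\rho(\alpha(y))\rho(x)+\mu(x\diamond y)\beta-\mu(y\diamond x)\beta\big),$$ $$\mu(\alpha(y))\mu(x)=\mu(x\diamond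 y)\beta-\tfrac13\big(-\mu(y\diamond x)\beta+\rho(\alpha(y))\mu(x)+\rho(\alpha(x))\mu(y)-\rho(\alpha(x))\rho(y)\big).$$ Matched pair: given admissible Hom-Poisson algebras $(A_1,\diamond_1,\alpha_1)$, $(A_2,\diamond_2,\alpha_2)$ and linear maps $\rho_1,\mu_1:A_1\to\mathrm{End}(A_2)$, $\rho_2,\mu_2:A_2\to\mathrm{End}(A_1)$, the tuple $(A_1,A_2,\rho_1,\mu_1,\rho_2,\mu_2,\alpha_1,\alpha_2)$ is a matched pair of admissible Hom-Poisson algebras if $(A_2,\rho_1,\mu_1,\alpha_2)$ is a representation of $(A_1,\diamond_1,\alpha_1)$, $(A_1,\rho_2,\mu_2,\alpha_1)$ is a representation of $(A_2,\diamond_2,\alpha_2)$, and for all $x,y\in A_1$, $a\in A_2$: (M1) $\mu_2(\alpha_2(a))(x\diamond_1y)=\mu_2(\rho_1(y)a)(\alpha_1(x))+\alpha_1(x)\diamond_1(\mu_2(a)y)+\frac13\big(\mu_2(\mu_1(y)a)(\alpha_1(x))+\alpha_1(x)\diamond_1(\rho_2(a)y)-\rho_2(\alpha_2(a))(x\diamond_1y)-\alpha_1(y)\diamond_1(\mu_2(a)x)-\mu_2(\rho_1(x)a)(\alpha_1(y))+\alpha_1(y)\diamond_1(\rho_2(a)x)+\mu_2(\mu_1(x)a)(\alpha_1(y))\big)$; (M2) $\rho_2(\alpha_2(a))(x\diamond_1y)=(\rho_2(a)x)\diamond_1\alpha_1(y)+\rho_2(\mu_1(x)a)(\alpha_1(y))+\frac13\big(-\rho_2(\alpha_2(a))(y\diamond_1x)+\alpha_1(y)\diamond_1(\rho_2(a)x)+\mu_2(\mu_1(x)a)(\alpha_1(y))+\alpha_1(x)\diamond_1(\rho_2(a)y)+\mu_2(\mu_1(y)a)(\alpha_1(x))-\alpha_1(x)\diamond_1(\mu_2(a)y)-\mu_2(\rho_1(y)a)(\alpha_1(x))\big)$;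 (M3) $(\mu_2(a)x)\diamond_1\alpha_1(y)=-\rho_2(\rho_1(x)a)(\alpha_1(y))+\alpha_1(x)\diamond_1(\rho_2(a)y)+\mu_2(\mu_1(y)a)(\alpha_1(x))+\frac13\big(\alpha_1(x)\diamond_1(\mu_2(a)y)+\mu_2(\rho_1(y)a)(\alpha_1(x))-\alpha_1(y)\diamond_1(\mu_2(a)x)-\mu_2(\rho_1(x)a)(\alpha_1(y))-\rho_2(\alpha_2(a))(x\diamond_1y)+\rho_2(\alpha_2(a))(y\diamond_1x)\big)$; together with (M4), (M5), (M6), the identities obtained from (M1), (M2), (M3) respectively by interchanging the indices $1$ and $2$ and taking $a,b\in A_2$ in place of $x,y$ and $x\in A_1$ in place of $a$. Duals: for a linear map $T$, $T^*$ is the dual map, $\langle T^*(w^* ),v\rangle=\langle w^*,T(v)\rangle$; for $\rho:A\to\mathrm{End}(V)$, $\rho^*:A\to\mathrm{End}(V^* )$ is given by $\langle\rho^*(x)\xi,v\rangle=-\langle\xi,\rho(x)v\rangle$. $L_A(x)y=x\diamond_A y$, $R_A(x)y=y\diamond_A x$, and similarly $L_{A^*},R_{A^*}$ for $\diamond_{A^*}$. For $x\in A$, $\xi\in A^*$: $L_A^\star(x)\xi=L_A^*(\alpha(x))\big((\alpha^{-2})^*\xi\big)$, $R_A^\star(x)\xi=R_A^*(\alpha(x))\big((\alpha^{-2})^*\xi\big)$, and (identifying $A^{**}=A$) $L_{A^*}^\star(\xi)x=L_{A^*}^*\big((\alpha^{-1})^*\xi\big)(\alpha^2(x))$, $R_{A^*}^\star(\xi)x=R_{A^*}^*\big((\alpha^{-1})^*\xi\big)(\alpha^2(x))$.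 Standard Manin triple: $(A\oplus A^*,A,A^* )$ is a standard Manin triple associated to $B_d$ if there exists an admissible Hom-Poisson algebra structure on $A\oplus A^*$ with twist $\alpha\oplus(\alpha^{-1})^*$ such that $(A,\diamond_A,\alpha)$ and $(A^*,\diamond_{A^*},(\alpha^{-1})^* )$ are subalgebras and $B_d$ is invariant, i.e. writing $\diamond$ and $\widehat\alpha$ for the product and twist on $A\oplus A^*$, $B_d(\widehat\alpha(X),\widehat\alpha(Y))=B_d(X,Y)$ and $B_d(X\diamond Y,\widehat\alpha(Z))=B_d(\widehat\alpha(X),Y\diamond Z)$ for all $X,Y,Z\in A\oplus A^*$. *)

theory Defs
  imports "HOL-Analysis.Product_Vector" "HOL-Library.Function_Algebras"
begin

text \<open>
  Vector spaces are finite-dimensional subspaces of an ambient vector space. The carrier is explicit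
  because the dual \<open>A\<^sup>*\<close>, the sum \<open>A \<oplus> A\<^sup>*\<close> and the bidual are again to be spaces of this kind.
  Maps between such spaces are constrained on the carriers only.
\<close>

locale fd_space = vector_space scale
  for scale :: "'f::field \<Rightarrow> 'v::ab_group_add \<Rightarrow> 'v" +
  fixes V :: "'v set"
  assumes subspace_carrier: "subspace V"
    and finite_dimensional: "\<exists>B. finite B \<and> span B = V"

definition linear_on ::
  "('f::field \<Rightarrow> 'v::ab_group_add \<Rightarrow> 'v) \<Rightarrow> ('f \<Rightarrow> 'w::ab_group_add \<Rightarrow> 'w) \<Rightarrow> 'v set \<Rightarrow> 'w set
    \<Rightarrow> ('v \<Rightarrow> 'w) \<Rightarrow> bool" where
  "linear_on s1 s2 V W f \<longleftrightarrow>
    (\<forall>x\<in>V. f x \<in> W) \<and>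
    (\<forall>x\<in>V. \<forall>y\<in>V. f (x + y) = f x + f y) \<and>
    (\<forall>c. \<forall>x\<in>V. f (s1 c x) = s2 c (f x))"

text \<open>Applied to a map \<open>A \<Rightarrow> V \<Rightarrow> V\<close>, this says that it is a linear map \<open>A \<rightarrow> End(V)\<close>.\<close>

definition bilinear_on ::
  "('f::field \<Rightarrow> 'u::ab_group_add \<Rightarrow> 'u) \<Rightarrow> ('f \<Rightarrow> 'v::ab_group_add \<Rightarrow> 'v) \<Rightarrow> ('f \<Rightarrow> 'w::ab_group_add \<Rightarrow> 'w)
    \<Rightarrow> 'u set \<Rightarrow> 'v set \<Rightarrow> 'w set \<Rightarrow> ('u \<Rightarrow> 'v \<Rightarrow> 'w) \<Rightarrow> bool" where
  "bilinear_on s1 s2 s3 U V W f \<longleftrightarrow>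
    (\<forall>x\<in>U. linear_on s2 s3 V W (f x)) \<and> (\<forall>y\<in>V. linear_on s1 s3 U W (\<lambda>x. f x y))"

locale admissible_hom_poisson = fd_space scale A
  for scale :: "'f::field \<Rightarrow> 'a::ab_group_add \<Rightarrow> 'a" and A :: "'a set" +
  fixes mult :: "'a \<Rightarrow> 'a \<Rightarrow> 'a" (infixl "\<diamondop>" 70)
    and \<alpha> :: "'a \<Rightarrow> 'a"
  assumes bilinear_mult: "bilinear_on scale scale scale A A A mult"
    and linear_twist: "linear_on scale scale A A \<alpha>"
    and multiplicative: "\<lbrakk>x \<in> A; y \<in> A\<rbrakk> \<Longrightarrow> \<alpha> (x \<diamondop> y) = \<alpha> x \<diamondop> \<alpha> y"
    and admissible: "\<lbrakk>x \<in> A; y \<in> A; z \<in> A\<rbrakk> \<Longrightarrow>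
      (x \<diamondop> y) \<diamondop> \<alpha> z =
        \<alpha> x \<diamondop> (y \<diamondop> z)
        - scale (1/3) (- (\<alpha> x \<diamondop> (z \<diamondop> y)) + \<alpha> z \<diamondop> (x \<diamondop> y) + \<alpha> y \<diamondop> (x \<diamondop> z) - \<alpha> y \<diamondop> (z \<diamondop> x))"

definition regular_twist :: "'a set \<Rightarrow> ('a \<Rightarrow> 'a) \<Rightarrow> bool" where
  "regular_twist A \<alpha> \<longleftrightarrow> bij_betw \<alpha> A A"

locale hom_poisson_representation =
  alg: admissible_hom_poisson scaleA A mult \<alpha> + rep: fd_space scaleV V
  for scaleA :: "'f::field \<Rightarrow> 'a::ab_group_add \<Rightarrow> 'a" and A :: "'a set"
    and mult :: "'a \<Rightarrow> 'a \<Rightarrow> 'a" (infixl "\<diamondop>" 70) and \<alpha> :: "'a \<Rightarrow> 'a"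
    and scaleV :: "'f \<Rightarrow> 'v::ab_group_add \<Rightarrow> 'v" and V :: "'v set" +
  fixes \<rho> \<mu> :: "'a \<Rightarrow> 'v \<Rightarrow> 'v" and \<beta> :: "'v \<Rightarrow> 'v"
  assumes linear_rho: "bilinear_on scaleA scaleV scaleV A V V \<rho>"
    and linear_mu: "bilinear_on scaleA scaleV scaleV A V V \<mu>"
    and linear_beta: "linear_on scaleV scaleV V V \<beta>"
    and rho_beta: "\<lbrakk>x \<in> A; v \<in> V\<rbrakk> \<Longrightarrow> \<rho> (\<alpha> x) (\<beta> v) = \<beta> (\<rho> x v)"
    and mu_beta: "\<lbrakk>x \<in> A; v \<in> V\<rbrakk> \<Longrightarrow> \<mu> (\<alpha> x) (\<beta> v) = \<beta> (\<mu> x v)"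
    and rep1: "\<lbrakk>x \<in> A; y \<in> A; v \<in> V\<rbrakk> \<Longrightarrow>
      \<rho> (x \<diamondop> y) (\<beta> v) =
        \<rho> (\<alpha> x) (\<rho> y v)
        - scaleV (1/3) (- \<rho> (\<alpha> x) (\<mu> y v) + \<mu> (x \<diamondop> y) (\<beta> v) + \<rho> (\<alpha> y) (\<rho> x v) - \<rho> (\<alpha> y) (\<mu> x v))"
    and rep2: "\<lbrakk>x \<in> A; y \<in> A; v \<in> V\<rbrakk> \<Longrightarrow>
      \<mu> (\<alpha> y) (\<rho> x v) =
        \<rho> (\<alpha> x) (\<mu> y v)
        - scaleV (1/3) (- \<rho> (\<alpha> x) (\<rho> y v) + \<rho> (\<alpha> y) (\<rho> x v) + \<mu> (x \<diamondop> y) (\<beta> v) - \<mu> (y \<diamondop> x) (\<beta> v))"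
    and rep3: "\<lbrakk>x \<in> A; y \<in> A; v \<in> V\<rbrakk> \<Longrightarrow>
      \<mu> (\<alpha> y) (\<mu> x v) =
        \<mu> (x \<diamondop> y) (\<beta> v)
        - scaleV (1/3) (- \<mu> (y \<diamondop> x) (\<beta> v) + \<rho> (\<alpha> y) (\<mu> x v) + \<rho> (\<alpha> x) (\<mu> y v) - \<rho> (\<alpha> x) (\<rho> y v))"

text \<open>The compatibility conditions of a matched pair that take values in \<open>A\<^sub>1\<close>.\<close>

locale matched_pair_identities =
  fixes scale1 :: "'f::field \<Rightarrow> 'a::ab_group_add \<Rightarrow> 'a" and A1 :: "'a set" and A2 :: "'b set"
    and mult1 :: "'a \<Rightarrow> 'a \<Rightarrow> 'a" (infixl "\<diamondop>" 70)
    and \<rho>1 \<mu>1 :: "'a \<Rightarrow> 'b \<Rightarrow> 'b" and \<rho>2 \<mu>2 :: "'b \<Rightarrow> 'a \<Rightarrow> 'a"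
    and \<alpha>1 :: "'a \<Rightarrow> 'a" and \<alpha>2 :: "'b \<Rightarrow> 'b"
  assumes matched1: "\<lbrakk>x \<in> A1; y \<in> A1; a \<in> A2\<rbrakk> \<Longrightarrow>
      \<mu>2 (\<alpha>2 a) (x \<diamondop> y) =
        \<mu>2 (\<rho>1 y a) (\<alpha>1 x) + \<alpha>1 x \<diamondop> \<mu>2 a y
        + scale1 (1/3) (\<mu>2 (\<mu>1 y a) (\<alpha>1 x) + \<alpha>1 x \<diamondop> \<rho>2 a y - \<rho>2 (\<alpha>2 a) (x \<diamondop> y)
            - \<alpha>1 y \<diamondop> \<mu>2 a x - \<mu>2 (\<rho>1 x a) (\<alpha>1 y) + \<alpha>1 y \<diamondop> \<rho>2 a x + \<mu>2 (\<mu>1 x a) (\<alpha>1 y))"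
    and matched2: "\<lbrakk>x \<in> A1; y \<in> A1; a \<in> A2\<rbrakk> \<Longrightarrow>
      \<rho>2 (\<alpha>2 a) (x \<diamondop> y) =
        \<rho>2 a x \<diamondop> \<alpha>1 y + \<rho>2 (\<mu>1 x a) (\<alpha>1 y)
        + scale1 (1/3) (- \<rho>2 (\<alpha>2 a) (y \<diamondop> x) + \<alpha>1 y \<diamondop> \<rho>2 a x + \<mu>2 (\<mu>1 x a) (\<alpha>1 y)
            + \<alpha>1 x \<diamondop> \<rho>2 a y + \<mu>2 (\<mu>1 y a) (\<alpha>1 x) - \<alpha>1 x \<diamondop> \<mu>2 a y - \<mu>2 (\<rho>1 y a) (\<alpha>1 x))"
    and matched3: "\<lbrakk>x \<in> A1; y \<in> A1; a \<in> A2\<rbrakk> \<Longrightarrow>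
      \<mu>2 a x \<diamondop> \<alpha>1 y =
        - \<rho>2 (\<rho>1 x a) (\<alpha>1 y) + \<alpha>1 x \<diamondop> \<rho>2 a y + \<mu>2 (\<mu>1 y a) (\<alpha>1 x)
        + scale1 (1/3) (\<alpha>1 x \<diamondop> \<mu>2 a y + \<mu>2 (\<rho>1 y a) (\<alpha>1 x) - \<alpha>1 y \<diamondop> \<mu>2 a x
            - \<mu>2 (\<rho>1 x a) (\<alpha>1 y) - \<rho>2 (\<alpha>2 a) (x \<diamondop> y) + \<rho>2 (\<alpha>2 a) (y \<diamondop> x))"

definition matched_pair_hom_poisson ::
  "('f::field \<Rightarrow> 'a::ab_group_add \<Rightarrow> 'a) \<Rightarrow> ('f \<Rightarrow> 'b::ab_group_add \<Rightarrow> 'b) \<Rightarrow> 'a set \<Rightarrow> 'b set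
    \<Rightarrow> ('a \<Rightarrow> 'a \<Rightarrow> 'a) \<Rightarrow> ('b \<Rightarrow> 'b \<Rightarrow> 'b)
    \<Rightarrow> ('a \<Rightarrow> 'b \<Rightarrow> 'b) \<Rightarrow> ('a \<Rightarrow> 'b \<Rightarrow> 'b) \<Rightarrow> ('b \<Rightarrow> 'a \<Rightarrow> 'a) \<Rightarrow> ('b \<Rightarrow> 'a \<Rightarrow> 'a)
    \<Rightarrow> ('a \<Rightarrow> 'a) \<Rightarrow> ('b \<Rightarrow> 'b) \<Rightarrow> bool" where
  "matched_pair_hom_poisson scale1 scale2 A1 A2 mult1 mult2 \<rho>1 \<mu>1 \<rho>2 \<mu>2 \<alpha>1 \<alpha>2 \<longleftrightarrow>
    admissible_hom_poisson scale1 A1 mult1 \<alpha>1 \<and>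
    admissible_hom_poisson scale2 A2 mult2 \<alpha>2 \<and>
    hom_poisson_representation scale1 A1 mult1 \<alpha>1 scale2 A2 \<rho>1 \<mu>1 \<alpha>2 \<and>
    hom_poisson_representation scale2 A2 mult2 \<alpha>2 scale1 A1 \<rho>2 \<mu>2 \<alpha>1 \<and>
    matched_pair_identities scale1 A1 A2 mult1 \<rho>1 \<mu>1 \<rho>2 \<mu>2 \<alpha>1 \<alpha>2 \<and>
    matched_pair_identities scale2 A2 A1 mult2 \<rho>2 \<mu>2 \<rho>1 \<mu>1 \<alpha>2 \<alpha>1"

text \<open>
  A functional on a carrier \<open>V\<close> is represented by its extension by \<open>0\<close> outside \<open>V\<close>, so that
  equality in the dual space is equality of functions.
\<close>

definition dual_space ::
  "('f::field \<Rightarrow> 'v::ab_group_add \<Rightarrow> 'v) \<Rightarrow> 'v set \<Rightarrow> ('v \<Rightarrow> 'f) set" where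
  "dual_space s V = {\<xi>. linear_on s (*) V UNIV \<xi> \<and> (\<forall>v. v \<notin> V \<longrightarrow> \<xi> v = 0)}"

definition dual_scale :: "'f::field \<Rightarrow> ('v \<Rightarrow> 'f) \<Rightarrow> 'v \<Rightarrow> 'f" where
  "dual_scale c \<xi> = (\<lambda>v. c * \<xi> v)"

text \<open>For \<open>T : V \<rightarrow> W\<close>, this is \<open>T\<^sup>* : W\<^sup>* \<rightarrow> V\<^sup>*\<close>.\<close>

definition dual_map :: "'v set \<Rightarrow> ('v \<Rightarrow> 'w) \<Rightarrow> ('w \<Rightarrow> 'f::field) \<Rightarrow> 'v \<Rightarrow> 'f" where
  "dual_map V T \<xi> = (\<lambda>v. if v \<in> V then \<xi> (T v) else 0)"

text \<open>The map \<open>\<rho>\<^sup>* : A \<rightarrow> End(V\<^sup>*)\<close> with its sign, for \<open>\<rho> : A \<rightarrow> End(V)\<close>.\<close>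

definition dual_rep :: "'v set \<Rightarrow> ('a \<Rightarrow> 'v \<Rightarrow> 'v) \<Rightarrow> 'a \<Rightarrow> ('v \<Rightarrow> 'f::field) \<Rightarrow> 'v \<Rightarrow> 'f" where
  "dual_rep V \<rho> x \<xi> = (\<lambda>v. if v \<in> V then - \<xi> (\<rho> x v) else 0)"

definition bidual_embedding ::
  "('f::field \<Rightarrow> 'v::ab_group_add \<Rightarrow> 'v) \<Rightarrow> 'v set \<Rightarrow> 'v \<Rightarrow> ('v \<Rightarrow> 'f) \<Rightarrow> 'f" where
  "bidual_embedding s V v = (\<lambda>\<xi>. if \<xi> \<in> dual_space s V then \<xi> v else 0)"

definition left_mult :: "('a \<Rightarrow> 'a \<Rightarrow> 'a) \<Rightarrow> 'a \<Rightarrow> 'a \<Rightarrow> 'a" where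
  "left_mult mult x y = mult x y"

definition right_mult :: "('a \<Rightarrow> 'a \<Rightarrow> 'a) \<Rightarrow> 'a \<Rightarrow> 'a \<Rightarrow> 'a" where
  "right_mult mult x y = mult y x"

text \<open>\<open>\<rho>\<^sup>\<star>(x)\<xi> = \<rho>\<^sup>*(\<alpha>(x))((\<alpha>\<^sup>-\<^sup>2)\<^sup>*\<xi>)\<close>, for \<open>\<rho>\<close> one of the two multiplications of \<open>A\<close>.\<close>

definition star_rep ::
  "'a set \<Rightarrow> ('a \<Rightarrow> 'a) \<Rightarrow> ('a \<Rightarrow> 'a \<Rightarrow> 'a) \<Rightarrow> 'a \<Rightarrow> ('a \<Rightarrow> 'f::field) \<Rightarrow> 'a \<Rightarrow> 'f" where
  "star_rep A \<alpha> \<rho> x \<xi> =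
    dual_rep A \<rho> (\<alpha> x) (dual_map A (inv_into A \<alpha> \<circ> inv_into A \<alpha>) \<xi>)"

text \<open>
  \<open>\<rho>\<^sup>\<star>(\<xi>)x = \<rho>\<^sup>*((\<alpha>\<^sup>-\<^sup>1)\<^sup>*\<xi>)(\<alpha>\<^sup>2(x))\<close>, for \<open>\<rho>\<close> one of the two multiplications of \<open>A\<^sup>*\<close>. Here \<open>\<rho>\<^sup>*\<close> acts on
  the bidual of \<open>A\<close>, which is identified with \<open>A\<close> through \<^const>\<open>bidual_embedding\<close>.
\<close>

definition star_rep_dual ::
  "('f::field \<Rightarrow> 'a::ab_group_add \<Rightarrow> 'a) \<Rightarrow> 'a set \<Rightarrow> ('a \<Rightarrow> 'a)
    \<Rightarrow> (('a \<Rightarrow> 'f) \<Rightarrow> ('a \<Rightarrow> 'f) \<Rightarrow> 'a \<Rightarrow> 'f) \<Rightarrow> ('a \<Rightarrow> 'f) \<Rightarrow> 'a \<Rightarrow> 'a" where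
  "star_rep_dual s A \<alpha> \<rho> \<xi> x =
    inv_into A (bidual_embedding s A)
      (dual_rep (dual_space s A) \<rho> (dual_map A (inv_into A \<alpha>) \<xi>) (bidual_embedding s A (\<alpha> (\<alpha> x))))"

text \<open>
  An element \<open>t\<close> of \<open>A \<otimes> A\<close> is represented by the bilinear form \<open>(\<xi>, \<eta>) \<mapsto> \<langle>\<xi> \<otimes> \<eta>, t\<rangle>\<close> on \<open>A\<^sup>*\<close>
  (extended by \<open>0\<close>); this represents \<open>A \<otimes> A\<close> faithfully because \<open>A\<^sup>*\<close> separates the points of \<open>A\<close>.
\<close>

definition pure_tensor ::
  "('f::field \<Rightarrow> 'a::ab_group_add \<Rightarrow> 'a) \<Rightarrow> 'a set \<Rightarrow> 'a \<Rightarrow> 'a \<Rightarrow> ('a \<Rightarrow> 'f) \<Rightarrow> ('a \<Rightarrow> 'f) \<Rightarrow> 'f" where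
  "pure_tensor s A x y =
    (\<lambda>\<xi> \<eta>. if \<xi> \<in> dual_space s A \<and> \<eta> \<in> dual_space s A then \<xi> x * \<eta> y else 0)"

definition tensor_scale :: "'f::field \<Rightarrow> ('v \<Rightarrow> 'w \<Rightarrow> 'f) \<Rightarrow> 'v \<Rightarrow> 'w \<Rightarrow> 'f" where
  "tensor_scale c t = (\<lambda>\<xi> \<eta>. c * t \<xi> \<eta>)"

definition tensor_square ::
  "('f::field \<Rightarrow> 'a::ab_group_add \<Rightarrow> 'a) \<Rightarrow> 'a set \<Rightarrow> (('a \<Rightarrow> 'f) \<Rightarrow> ('a \<Rightarrow> 'f) \<Rightarrow> 'f) set" where
  "tensor_square s A = module.span tensor_scale {pure_tensor s A x y |x y. x \<in> A \<and> y \<in> A}"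

text \<open>\<open>\<Delta>\<^sup>*(\<xi> \<otimes> \<eta>)\<close>, i.e. \<open>\<langle>\<Delta>\<^sup>*(\<xi> \<otimes> \<eta>), x\<rangle> = \<langle>\<xi> \<otimes> \<eta>, \<Delta>(x)\<rangle>\<close>.\<close>

definition dual_comult ::
  "'a set \<Rightarrow> ('a \<Rightarrow> ('a \<Rightarrow> 'f) \<Rightarrow> ('a \<Rightarrow> 'f) \<Rightarrow> 'f::field) \<Rightarrow> ('a \<Rightarrow> 'f) \<Rightarrow> ('a \<Rightarrow> 'f) \<Rightarrow> 'a \<Rightarrow> 'f" where
  "dual_comult A \<Delta> \<xi> \<eta> = (\<lambda>x. if x \<in> A then \<Delta> x \<xi> \<eta> else 0)"

definition hom_algebra_embedding ::
  "('f::field \<Rightarrow> 'a::ab_group_add \<Rightarrow> 'a) \<Rightarrow> 'a set \<Rightarrow> ('a \<Rightarrow> 'a \<Rightarrow> 'a) \<Rightarrow> ('a \<Rightarrow> 'a)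
    \<Rightarrow> ('f \<Rightarrow> 'b::ab_group_add \<Rightarrow> 'b) \<Rightarrow> 'b set \<Rightarrow> ('b \<Rightarrow> 'b \<Rightarrow> 'b) \<Rightarrow> ('b \<Rightarrow> 'b)
    \<Rightarrow> ('a \<Rightarrow> 'b) \<Rightarrow> bool" where
  "hom_algebra_embedding s1 A1 mult1 \<alpha>1 s2 A2 mult2 \<alpha>2 \<iota> \<longleftrightarrow>
    linear_on s1 s2 A1 A2 \<iota> \<and> inj_on \<iota> A1 \<and>
    (\<forall>x\<in>A1. \<forall>y\<in>A1. \<iota> (mult1 x y) = mult2 (\<iota> x) (\<iota> y)) \<and>
    (\<forall>x\<in>A1. \<iota> (\<alpha>1 x) = \<alpha>2 (\<iota> x))"

definition invariant_form ::
  "'v set \<Rightarrow> ('v \<Rightarrow> 'v \<Rightarrow> 'v) \<Rightarrow> ('v \<Rightarrow> 'v) \<Rightarrow> ('v \<Rightarrow> 'v \<Rightarrow> 'f) \<Rightarrow> bool" where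
  "invariant_form V mult \<alpha> B \<longleftrightarrow>
    (\<forall>X\<in>V. \<forall>Y\<in>V. B (\<alpha> X) (\<alpha> Y) = B X Y) \<and>
    (\<forall>X\<in>V. \<forall>Y\<in>V. \<forall>Z\<in>V. B (mult X Y) (\<alpha> Z) = B (\<alpha> X) (mult Y Z))"

definition Bd :: "'a \<times> ('a \<Rightarrow> 'f::field) \<Rightarrow> 'a \<times> ('a \<Rightarrow> 'f) \<Rightarrow> 'f" where
  "Bd X Y = snd Y (fst X) + snd X (fst Y)"

text \<open>
  The sum \<open>A \<oplus> A\<^sup>*\<close> is the product \<open>A \<times> A\<^sup>*\<close>, with \<open>A\<close> and \<open>A\<^sup>*\<close> embedded as the two factors.
\<close>

definition standard_manin_triple ::
  "('f::field \<Rightarrow> 'a::ab_group_add \<Rightarrow> 'a) \<Rightarrow> 'a set \<Rightarrow> ('a \<Rightarrow> 'a \<Rightarrow> 'a) \<Rightarrow> ('a \<Rightarrow> 'a)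
    \<Rightarrow> (('a \<Rightarrow> 'f) \<Rightarrow> ('a \<Rightarrow> 'f) \<Rightarrow> 'a \<Rightarrow> 'f) \<Rightarrow> bool" where
  "standard_manin_triple s A multA \<alpha> multD \<longleftrightarrow>
    (let D = dual_space s A;
         \<alpha>D = dual_map A (inv_into A \<alpha>);
         S = A \<times> D;
         sS = module_prod.scale s dual_scale;
         \<alpha>S = map_prod \<alpha> \<alpha>D
     in \<exists>mult.
       admissible_hom_poisson sS S mult \<alpha>S \<and>
       hom_algebra_embedding s A multA \<alpha> sS S mult \<alpha>S (\<lambda>x. (x, 0)) \<and>
       hom_algebra_embedding dual_scale D multD \<alpha>D sS S mult \<alpha>S (\<lambda>\<xi>. (0, \<xi>)) \<and>
       invariant_form S mult \<alpha>S Bd)"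

end

theory Submission
  imports Defs
begin

text \<open>
  Let \<open>\<rho>\<^sub>1, \<mu>\<^sub>1\<close> be actions of \<open>A\<^sub>1\<close> on \<open>A\<^sub>2\<close> and \<open>\<rho>\<^sub>2, \<mu>\<^sub>2\<close> actions of \<open>A\<^sub>2\<close> on \<open>A\<^sub>1\<close>. They define
  the bicrossed product
  \<open>(x, a) \<diamondop> (y, b) = (x \<diamondop> y + \<rho>\<^sub>2(a)y + \<mu>\<^sub>2(b)x, a \<diamondop> b + \<rho>\<^sub>1(x)b + \<mu>\<^sub>1(y)a)\<close> on \<open>A\<^sub>1 \<oplus> A\<^sub>2\<close>.
  The proof has two independent halves.

  The first holds for any such actions: the bicrossed product is an admissible Hom-Poisson algebra iff
  the actions form a matched pair (\<open>admissible_bicrossed_iff_matched_pair\<close>). The defect of the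
  admissible identity is trilinear, so it vanishes iff it vanishes on homogeneous arguments, and
  its homogeneous components are the identities of the two algebras, the representation
  identities and the six matched pair identities. In the same way, multiplicativity splits into that of
  the two algebras and the compatibility of the actions with the twists.

  The second concerns the form \<open>Bd\<close> on \<open>A \<oplus> A\<^sup>*\<close>. In terms of the pairing, the negated star
  representations satisfy four adjointness relations (\<open>adjointness\<close>), and by these the bicrossed
  product is invariant (\<open>invariant_form_bicrossed\<close>). Conversely, invariance prescribes the
  pairings of every mixed product; as the pairing is nondegenerate, the bicrossed product is
  the only bilinear invariant product extending those of \<open>A\<close> and \<open>A\<^sup>*\<close> (\<open>invariant_product_eq_bicrossed\<close>). So a
  standard Manin triple exists iff the bicrossed product is admissible, which by the first half is the
  matched pair condition. Finite dimension enters where an element of the bidual has to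
  be an evaluation (\<open>ex_evaluation\<close>), which makes the star representations of \<open>A\<^sup>*\<close> well defined.
\<close>

section \<open>Linear and bilinear maps on carriers\<close>

lemma linear_onI:
  assumes "\<And>x. x \<in> V \<Longrightarrow> f x \<in> W"
    and "\<And>x y. x \<in> V \<Longrightarrow> y \<in> V \<Longrightarrow> f (x + y) = f x + f y"
    and "\<And>c x. x \<in> V \<Longrightarrow> f (s1 c x) = s2 c (f x)"
  shows "linear_on s1 s2 V W f"
  using assms by (simp add: linear_on_def)

lemma bilinear_onI:
  assumes "\<And>x y. x \<in> U \<Longrightarrow> y \<in> V \<Longrightarrow> f x y \<in> W"
    and "\<And>x x' y. x \<in> U \<Longrightarrow> x' \<in> U \<Longrightarrow> y \<in> V \<Longrightarrow> f (x + x') y = f x y + f x' y"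
    and "\<And>x y y'. x \<in> U \<Longrightarrow> y \<in> V \<Longrightarrow> y' \<in> V \<Longrightarrow> f x (y + y') = f x y + f x y'"
    and "\<And>c x y. x \<in> U \<Longrightarrow> y \<in> V \<Longrightarrow> f (s1 c x) y = s3 c (f x y)"
    and "\<And>c x y. x \<in> U \<Longrightarrow> y \<in> V \<Longrightarrow> f x (s2 c y) = s3 c (f x y)"
  shows "bilinear_on s1 s2 s3 U V W f"
  using assms by (simp add: bilinear_on_def linear_on_def)

lemma bilinear_onD:
  assumes "bilinear_on s1 s2 s3 U V W f"
  shows bilinear_on_mem: "\<And>x y. x \<in> U \<Longrightarrow> y \<in> V \<Longrightarrow> f x y \<in> W"
    and bilinear_on_add_left:
      "\<And>x x' y. x \<in> U \<Longrightarrow> x' \<in> U \<Longrightarrow> y \<in> V \<Longrightarrow> f (x + x') y = f x y + f x' y"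
    and bilinear_on_add_right:
      "\<And>x y y'. x \<in> U \<Longrightarrow> y \<in> V \<Longrightarrow> y' \<in> V \<Longrightarrow> f x (y + y') = f x y + f x y'"
    and bilinear_on_scale_left: "\<And>c x y. x \<in> U \<Longrightarrow> y \<in> V \<Longrightarrow> f (s1 c x) y = s3 c (f x y)"
    and bilinear_on_scale_right: "\<And>c x y. x \<in> U \<Longrightarrow> y \<in> V \<Longrightarrow> f x (s2 c y) = s3 c (f x y)"
  using assms by (simp_all add: bilinear_on_def linear_on_def)

lemma bilinear_on_zero:
  assumes "bilinear_on s1 s2 s3 U V W f" "0 \<in> U" "0 \<in> V"
  shows bilinear_on_zero_left: "y \<in> V \<Longrightarrow> f 0 y = 0"
    and bilinear_on_zero_right: "x \<in> U \<Longrightarrow> f x 0 = 0"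
  using bilinear_on_add_left[OF assms(1) assms(2) assms(2), of y]
    bilinear_on_add_right[OF assms(1) _ assms(3) assms(3), of x] by simp_all

lemma linear_on_zero:
  assumes "linear_on s1 s2 V W f" "0 \<in> V"
  shows "f 0 = 0"
proof -
  have "f (0 + 0) = f 0 + f 0"
    using assms unfolding linear_on_def by blast
  then show ?thesis by simp
qed

section \<open>The defining identity as a trilinear defect\<close>

text \<open>
  For a bilinear product and a linear twist this is linear in each of its three arguments, so on a
  direct sum it vanishes as soon as it vanishes on homogeneous arguments.
\<close>

definition poisson_defect ::
  "('f::field \<Rightarrow> 'a::ab_group_add \<Rightarrow> 'a) \<Rightarrow> ('a \<Rightarrow> 'a \<Rightarrow> 'a) \<Rightarrow> ('a \<Rightarrow> 'a) \<Rightarrow> 'a \<Rightarrow> 'a \<Rightarrow> 'a \<Rightarrow> 'a" where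
  "poisson_defect s m \<alpha> x y z =
    m (m x y) (\<alpha> z) -
    (m (\<alpha> x) (m y z)
      - s (1/3) (- m (\<alpha> x) (m z y) + m (\<alpha> z) (m x y) + m (\<alpha> y) (m x z) - m (\<alpha> y) (m z x)))"

text \<open>
  An admissible Hom-Poisson algebra without multiplicativity and without the identity. For
  a product on a direct sum these are the two conditions at stake, and the notions here have to be
  available before either of them is known.
\<close>

locale hom_algebra = fd_space scale A
  for scale :: "'f::field \<Rightarrow> 'a::ab_group_add \<Rightarrow> 'a" and A :: "'a set" +
  fixes mult :: "'a \<Rightarrow> 'a \<Rightarrow> 'a" and \<alpha> :: "'a \<Rightarrow> 'a"
  assumes bilinear: "bilinear_on scale scale scale A A A mult"
    and linear: "linear_on scale scale A A \<alpha>"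
begin

lemma carrier_closed [simp]:
  "0 \<in> A" "x \<in> A \<Longrightarrow> y \<in> A \<Longrightarrow> x + y \<in> A" "x \<in> A \<Longrightarrow> y \<in> A \<Longrightarrow> x - y \<in> A"
  "x \<in> A \<Longrightarrow> - x \<in> A" "x \<in> A \<Longrightarrow> scale c x \<in> A"
  using subspace_carrier
  by (auto intro: subspace_0 subspace_add subspace_diff subspace_neg subspace_scale)

lemma twist_simps [simp]:
  "x \<in> A \<Longrightarrow> \<alpha> x \<in> A"
  "x \<in> A \<Longrightarrow> y \<in> A \<Longrightarrow> \<alpha> (x + y) = \<alpha> x + \<alpha> y"
  "x \<in> A \<Longrightarrow> \<alpha> (scale c x) = scale c (\<alpha> x)"
  "\<alpha> 0 = 0"
  using linear linear_on_zero[OF linear] by (auto simp: linear_on_def)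

lemma mult_simps [simp]:
  "x \<in> A \<Longrightarrow> y \<in> A \<Longrightarrow> mult x y \<in> A"
  "x \<in> A \<Longrightarrow> x' \<in> A \<Longrightarrow> y \<in> A \<Longrightarrow> mult (x + x') y = mult x y + mult x' y"
  "x \<in> A \<Longrightarrow> y \<in> A \<Longrightarrow> y' \<in> A \<Longrightarrow> mult x (y + y') = mult x y + mult x y'"
  "x \<in> A \<Longrightarrow> y \<in> A \<Longrightarrow> mult (scale c x) y = scale c (mult x y)"
  "x \<in> A \<Longrightarrow> y \<in> A \<Longrightarrow> mult x (scale c y) = scale c (mult x y)"
  "x \<in> A \<Longrightarrow> mult x 0 = 0"
  "x \<in> A \<Longrightarrow> mult 0 x = 0"
  using bilinear_onD[OF bilinear] bilinear_on_zero[OF bilinear] by auto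

lemma poisson_defect_add:
  assumes "x \<in> A" "y \<in> A" "z \<in> A" "w \<in> A"
  shows "poisson_defect scale mult \<alpha> (x + w) y z
      = poisson_defect scale mult \<alpha> x y z + poisson_defect scale mult \<alpha> w y z"
    and "poisson_defect scale mult \<alpha> x (y + w) z
      = poisson_defect scale mult \<alpha> x y z + poisson_defect scale mult \<alpha> x w z"
    and "poisson_defect scale mult \<alpha> x y (z + w)
      = poisson_defect scale mult \<alpha> x y z + poisson_defect scale mult \<alpha> x y w"
  using assms
  by (simp_all add: poisson_defect_def scale_right_distrib scale_right_diff_distrib)

end

lemma admissible_iff_defect:
  "admissible_hom_poisson s A m \<alpha> \<longleftrightarrow>
    hom_algebra s A m \<alpha> \<and>
    (\<forall>x\<in>A. \<forall>y\<in>A. \<alpha> (m x y) = m (\<alpha> x) (\<alpha> y)) \<and>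
    (\<forall>x\<in>A. \<forall>y\<in>A. \<forall>z\<in>A. poisson_defect s m \<alpha> x y z = 0)"
  unfolding admissible_hom_poisson_def admissible_hom_poisson_axioms_def
    hom_algebra_def hom_algebra_axioms_def poisson_defect_def right_minus_eq
  by blast

section \<open>The bicrossed product of two algebras acting on each other\<close>

lemma fd_space_Times:
  assumes "fd_space s1 A1" "fd_space s2 A2"
  shows "fd_space (module_prod.scale s1 s2) (A1 \<times> A2)"
proof -
  interpret a: fd_space s1 A1 by fact
  interpret b: fd_space s2 A2 by fact
  interpret vector_space_prod s1 s2 ..
  obtain B1 B2 where B: "finite B1" "a.span B1 = A1" "finite B2" "b.span B2 = A2"
    using a.finite_dimensional b.finite_dimensional by blast
  have "p.span (B1 \<times> {0} \<union> {0} \<times> B2) = A1 \<times> A2"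
    unfolding p.span_Un span_Times_sing1 span_Times_sing2 B by force
  moreover have "finite (B1 \<times> {0} \<union> {0} \<times> B2)"
    using B by simp
  ultimately have "\<exists>B. finite B \<and> p.span B = A1 \<times> A2"
    by blast
  then show ?thesis
    using subspace_Times[OF a.subspace_carrier b.subspace_carrier]
    by (simp add: fd_space_def fd_space_axioms_def p.vector_space_axioms)
qed

definition bicrossed_mult ::
  "('a::plus \<Rightarrow> 'a \<Rightarrow> 'a) \<Rightarrow> ('b::plus \<Rightarrow> 'b \<Rightarrow> 'b) \<Rightarrow> ('a \<Rightarrow> 'b \<Rightarrow> 'b) \<Rightarrow> ('a \<Rightarrow> 'b \<Rightarrow> 'b)
    \<Rightarrow> ('b \<Rightarrow> 'a \<Rightarrow> 'a) \<Rightarrow> ('b \<Rightarrow> 'a \<Rightarrow> 'a) \<Rightarrow> 'a \<times> 'b \<Rightarrow> 'a \<times> 'b \<Rightarrow> 'a \<times> 'b" where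
  "bicrossed_mult m1 m2 \<rho>1 \<mu>1 \<rho>2 \<mu>2 = (\<lambda>(x, a) (y, b).
    (m1 x y + \<rho>2 a y + \<mu>2 b x, m2 a b + \<rho>1 x b + \<mu>1 y a))"

text \<open>
  Bilinearity of the products and of the actions already makes the defect of the bicrossed product
  trilinear, so this is the setting in which it can be compared with the matched pair identities.
\<close>

locale mutual_actions =
  h1: hom_algebra s1 A1 m1 \<alpha>1 + h2: hom_algebra s2 A2 m2 \<alpha>2
  for s1 :: "'f::field \<Rightarrow> 'a::ab_group_add \<Rightarrow> 'a" and A1 m1 \<alpha>1
    and s2 :: "'f \<Rightarrow> 'b::ab_group_add \<Rightarrow> 'b" and A2 m2 \<alpha>2 +
  fixes \<rho>1 \<mu>1 :: "'a \<Rightarrow> 'b \<Rightarrow> 'b" and \<rho>2 \<mu>2 :: "'b \<Rightarrow> 'a \<Rightarrow> 'a"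
  assumes bilinear_rho1: "bilinear_on s1 s2 s2 A1 A2 A2 \<rho>1"
    and bilinear_mu1: "bilinear_on s1 s2 s2 A1 A2 A2 \<mu>1"
    and bilinear_rho2: "bilinear_on s2 s1 s1 A2 A1 A1 \<rho>2"
    and bilinear_mu2: "bilinear_on s2 s1 s1 A2 A1 A1 \<mu>2"
begin

abbreviation "sS \<equiv> module_prod.scale s1 s2"
abbreviation "mS \<equiv> bicrossed_mult m1 m2 \<rho>1 \<mu>1 \<rho>2 \<mu>2"
abbreviation "\<alpha>S \<equiv> map_prod \<alpha>1 \<alpha>2"

sublocale vp: vector_space_prod s1 s2 ..

lemmas action_simps [simp] =
  bilinear_onD[OF bilinear_rho1] bilinear_onD[OF bilinear_mu1]
  bilinear_onD[OF bilinear_rho2] bilinear_onD[OF bilinear_mu2]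
  bilinear_on_zero[OF bilinear_rho1 h1.carrier_closed(1) h2.carrier_closed(1)]
  bilinear_on_zero[OF bilinear_mu1 h1.carrier_closed(1) h2.carrier_closed(1)]
  bilinear_on_zero[OF bilinear_rho2 h2.carrier_closed(1) h1.carrier_closed(1)]
  bilinear_on_zero[OF bilinear_mu2 h2.carrier_closed(1) h1.carrier_closed(1)]

lemma hom_algebra_bicrossed: "hom_algebra sS (A1 \<times> A2) mS \<alpha>S"
proof -
  have "fd_space sS (A1 \<times> A2)"
    by (rule fd_space_Times) unfold_locales
  moreover have "bilinear_on sS sS sS (A1 \<times> A2) (A1 \<times> A2) (A1 \<times> A2) mS"
    by (rule bilinear_onI)
      (auto simp: bicrossed_mult_def vp.scale_prod h1.scale_right_distrib h2.scale_right_distrib)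
  moreover have "linear_on sS sS (A1 \<times> A2) (A1 \<times> A2) \<alpha>S"
    by (rule linear_onI) (auto simp: vp.scale_prod)
  ultimately show ?thesis
    by (simp add: hom_algebra_def hom_algebra_axioms_def)
qed

sublocale S: hom_algebra sS "A1 \<times> A2" mS \<alpha>S
  by (rule hom_algebra_bicrossed)

lemma swapped: "mutual_actions s2 A2 m2 \<alpha>2 s1 A1 m1 \<alpha>1 \<rho>2 \<mu>2 \<rho>1 \<mu>1"
  using mutual_actions_axioms unfolding mutual_actions_def mutual_actions_axioms_def by blast

abbreviation "dS \<equiv> poisson_defect sS mS \<alpha>S"

lemma defect_111:
  assumes "x \<in> A1" "y \<in> A1" "z \<in> A1"
  shows "dS (x, 0) (y, 0) (z, 0) = (poisson_defect s1 m1 \<alpha>1 x y z, 0)"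
  using assms by (simp add: poisson_defect_def bicrossed_mult_def vp.scale_prod zero_prod_def)

text \<open>
  On homogeneous arguments the defect of the bicrossed product splits into its two components. With
  two arguments from \<open>A\<^sub>1\<close> and one from \<open>A\<^sub>2\<close>, the position of the latter decides which conditions
  appear: the \<open>A\<^sub>1\<close>-component is one of the three matched pair identities, the \<open>A\<^sub>2\<close>-component one of
  the three representation identities.
\<close>

lemma defect_112:
  assumes "x \<in> A1" "y \<in> A1" "a \<in> A2"
  shows "dS (x, 0) (y, 0) (0, a) = 0 \<longleftrightarrow>
      \<mu>2 (\<alpha>2 a) (m1 x y) =
        \<mu>2 (\<rho>1 y a) (\<alpha>1 x) + m1 (\<alpha>1 x) (\<mu>2 a y)
        + s1 (1/3) (\<mu>2 (\<mu>1 y a) (\<alpha>1 x) + m1 (\<alpha>1 x) (\<rho>2 a y) - \<rho>2 (\<alpha>2 a) (m1 x y)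
            - m1 (\<alpha>1 y) (\<mu>2 a x) - \<mu>2 (\<rho>1 x a) (\<alpha>1 y) + m1 (\<alpha>1 y) (\<rho>2 a x) + \<mu>2 (\<mu>1 x a) (\<alpha>1 y)) \<and>
      \<rho>1 (m1 x y) (\<alpha>2 a) =
        \<rho>1 (\<alpha>1 x) (\<rho>1 y a)
        - s2 (1/3) (- \<rho>1 (\<alpha>1 x) (\<mu>1 y a) + \<mu>1 (m1 x y) (\<alpha>2 a) + \<rho>1 (\<alpha>1 y) (\<rho>1 x a) - \<rho>1 (\<alpha>1 y) (\<mu>1 x a))"
  unfolding poisson_defect_def right_minus_eq
  using assms
  by (simp add: bicrossed_mult_def vp.scale_prod zero_prod_def h1.scale_right_distrib
      h1.scale_right_diff_distrib algebra_simps)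

lemma defect_121:
  assumes "x \<in> A1" "y \<in> A1" "a \<in> A2"
  shows "dS (x, 0) (0, a) (y, 0) = 0 \<longleftrightarrow>
      m1 (\<mu>2 a x) (\<alpha>1 y) =
        - \<rho>2 (\<rho>1 x a) (\<alpha>1 y) + m1 (\<alpha>1 x) (\<rho>2 a y) + \<mu>2 (\<mu>1 y a) (\<alpha>1 x)
        + s1 (1/3) (m1 (\<alpha>1 x) (\<mu>2 a y) + \<mu>2 (\<rho>1 y a) (\<alpha>1 x) - m1 (\<alpha>1 y) (\<mu>2 a x)
            - \<mu>2 (\<rho>1 x a) (\<alpha>1 y) - \<rho>2 (\<alpha>2 a) (m1 x y) + \<rho>2 (\<alpha>2 a) (m1 y x)) \<and>
      \<mu>1 (\<alpha>1 y) (\<rho>1 x a) =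
        \<rho>1 (\<alpha>1 x) (\<mu>1 y a)
        - s2 (1/3) (- \<rho>1 (\<alpha>1 x) (\<rho>1 y a) + \<rho>1 (\<alpha>1 y) (\<rho>1 x a) + \<mu>1 (m1 x y) (\<alpha>2 a) - \<mu>1 (m1 y x) (\<alpha>2 a))"
  unfolding poisson_defect_def right_minus_eq
  using assms
  by (simp add: bicrossed_mult_def vp.scale_prod zero_prod_def h1.scale_right_distrib
      h1.scale_right_diff_distrib algebra_simps)

lemma defect_211:
  assumes "x \<in> A1" "y \<in> A1" "a \<in> A2"
  shows "dS (0, a) (x, 0) (y, 0) = 0 \<longleftrightarrow>
      \<rho>2 (\<alpha>2 a) (m1 x y) =
        m1 (\<rho>2 a x) (\<alpha>1 y) + \<rho>2 (\<mu>1 x a) (\<alpha>1 y)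
        + s1 (1/3) (- \<rho>2 (\<alpha>2 a) (m1 y x) + m1 (\<alpha>1 y) (\<rho>2 a x) + \<mu>2 (\<mu>1 x a) (\<alpha>1 y)
            + m1 (\<alpha>1 x) (\<rho>2 a y) + \<mu>2 (\<mu>1 y a) (\<alpha>1 x) - m1 (\<alpha>1 x) (\<mu>2 a y) - \<mu>2 (\<rho>1 y a) (\<alpha>1 x)) \<and>
      \<mu>1 (\<alpha>1 y) (\<mu>1 x a) =
        \<mu>1 (m1 x y) (\<alpha>2 a)
        - s2 (1/3) (- \<mu>1 (m1 y x) (\<alpha>2 a) + \<rho>1 (\<alpha>1 y) (\<mu>1 x a) + \<rho>1 (\<alpha>1 x) (\<mu>1 y a) - \<rho>1 (\<alpha>1 x) (\<rho>1 y a))"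
  unfolding poisson_defect_def right_minus_eq
  using assms
  by (simp add: bicrossed_mult_def vp.scale_prod zero_prod_def h1.scale_right_distrib
      h1.scale_right_diff_distrib algebra_simps) metis

text \<open>
  The conditions on the bicrossed product that involve at most one argument from \<open>A\<^sub>2\<close>. The remaining
  ones are the same conditions with the two algebras interchanged, so that only this half has to be
  compared with the definition of a matched pair.
\<close>

definition half_admissible :: bool where
  "half_admissible \<longleftrightarrow>
    (\<forall>x\<in>A1. \<forall>y\<in>A1. \<alpha>1 (m1 x y) = m1 (\<alpha>1 x) (\<alpha>1 y)) \<and>
    (\<forall>x\<in>A1. \<forall>a\<in>A2. \<alpha>2 (\<rho>1 x a) = \<rho>1 (\<alpha>1 x) (\<alpha>2 a) \<and> \<alpha>2 (\<mu>1 x a) = \<mu>1 (\<alpha>1 x) (\<alpha>2 a)) \<and>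
    (\<forall>x\<in>A1. \<forall>y\<in>A1. \<forall>z\<in>A1. dS (x, 0) (y, 0) (z, 0) = 0) \<and>
    (\<forall>x\<in>A1. \<forall>y\<in>A1. \<forall>a\<in>A2.
      dS (x, 0) (y, 0) (0, a) = 0 \<and> dS (x, 0) (0, a) (y, 0) = 0 \<and> dS (0, a) (x, 0) (y, 0) = 0)"

lemma half_admissible_iff:
  "half_admissible \<longleftrightarrow>
    admissible_hom_poisson s1 A1 m1 \<alpha>1 \<and>
    hom_poisson_representation s1 A1 m1 \<alpha>1 s2 A2 \<rho>1 \<mu>1 \<alpha>2 \<and>
    matched_pair_identities s1 A1 A2 m1 \<rho>1 \<mu>1 \<rho>2 \<mu>2 \<alpha>1 \<alpha>2"
  (is "_ \<longleftrightarrow> ?R")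
proof
  assume H: half_admissible
  have adm: "admissible_hom_poisson s1 A1 m1 \<alpha>1"
    unfolding admissible_iff_defect
    using H h1.hom_algebra_axioms by (simp add: half_admissible_def defect_111 zero_prod_def)
  have H': "dS (x, 0) (y, 0) (0, a) = 0" "dS (x, 0) (0, a) (y, 0) = 0" "dS (0, a) (x, 0) (y, 0) = 0"
    if "x \<in> A1" "y \<in> A1" "a \<in> A2" for x y a
    using H that unfolding half_admissible_def by blast+
  note components = iffD1[OF defect_112 H'(1)] iffD1[OF defect_121 H'(2)] iffD1[OF defect_211 H'(3)]
  have "hom_poisson_representation s1 A1 m1 \<alpha>1 s2 A2 \<rho>1 \<mu>1 \<alpha>2"
  proof (intro hom_poisson_representation.intro hom_poisson_representation_axioms.intro adm
      h2.fd_space_axioms bilinear_rho1 bilinear_mu1 h2.linear)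
    fix x v assume "x \<in> A1" "v \<in> A2"
    then show "\<rho>1 (\<alpha>1 x) (\<alpha>2 v) = \<alpha>2 (\<rho>1 x v)" "\<mu>1 (\<alpha>1 x) (\<alpha>2 v) = \<alpha>2 (\<mu>1 x v)"
      using H unfolding half_admissible_def by simp_all
  qed (rule components[THEN conjunct2]; assumption)+
  moreover have "matched_pair_identities s1 A1 A2 m1 \<rho>1 \<mu>1 \<rho>2 \<mu>2 \<alpha>1 \<alpha>2"
    by unfold_locales (rule components[THEN conjunct1]; assumption)+
  ultimately show ?R using adm by blast
next
  assume ?R
  then interpret r: hom_poisson_representation s1 A1 m1 \<alpha>1 s2 A2 \<rho>1 \<mu>1 \<alpha>2
    + mp: matched_pair_identities s1 A1 A2 m1 \<rho>1 \<mu>1 \<rho>2 \<mu>2 \<alpha>1 \<alpha>2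
    by blast+
  have "poisson_defect s1 m1 \<alpha>1 x y z = 0" if "x \<in> A1" "y \<in> A1" "z \<in> A1" for x y z
    using that \<open>?R\<close> unfolding admissible_iff_defect by blast
  moreover have "dS (x, 0) (y, 0) (0, a) = 0" "dS (x, 0) (0, a) (y, 0) = 0"
      "dS (0, a) (x, 0) (y, 0) = 0"
    if "x \<in> A1" "y \<in> A1" "a \<in> A2" for x y a
    unfolding defect_112[OF that] defect_121[OF that] defect_211[OF that]
    by (intro conjI mp.matched1 mp.matched2 mp.matched3 r.rep1 r.rep2 r.rep3 that)+
  ultimately show half_admissible
    using r.alg.multiplicative r.rho_beta r.mu_beta
    by (auto simp: half_admissible_def defect_111 zero_prod_def)
qed

text \<open>
  Interchanging the two algebras amounts to transporting the bicrossed product along the swap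
  \<open>A\<^sub>1 \<times> A\<^sub>2 \<rightarrow> A\<^sub>2 \<times> A\<^sub>1\<close>.
\<close>

lemma defect_swap:
  "poisson_defect (module_prod.scale s2 s1) (bicrossed_mult m2 m1 \<rho>2 \<mu>2 \<rho>1 \<mu>1) (map_prod \<alpha>2 \<alpha>1)
      (prod.swap X) (prod.swap Y) (prod.swap Z) = prod.swap (dS X Y Z)"
proof -
  interpret sw: mutual_actions s2 A2 m2 \<alpha>2 s1 A1 m1 \<alpha>1 \<rho>2 \<mu>2 \<rho>1 \<mu>1
    by (rule swapped)
  have sw: "bicrossed_mult m2 m1 \<rho>2 \<mu>2 \<rho>1 \<mu>1 (prod.swap U) (prod.swap V) = prod.swap (mS U V)"
    "map_prod \<alpha>2 \<alpha>1 (prod.swap U) = prod.swap (\<alpha>S U)" for U V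
    by (simp_all add: bicrossed_mult_def prod.swap_def split_beta algebra_simps)
  show ?thesis
    unfolding poisson_defect_def sw
    by (simp add: prod.swap_def vp.scale_def sw.vp.scale_def)
qed

lemma defect_bicrossed_iff:
  "(\<forall>X\<in>A1 \<times> A2. \<forall>Y\<in>A1 \<times> A2. \<forall>Z\<in>A1 \<times> A2. dS X Y Z = 0) \<longleftrightarrow>
    (\<forall>x\<in>A1. \<forall>y\<in>A1. \<forall>z\<in>A1. dS (x, 0) (y, 0) (z, 0) = 0) \<and>
    (\<forall>x\<in>A1. \<forall>y\<in>A1. \<forall>a\<in>A2.
      dS (x, 0) (y, 0) (0, a) = 0 \<and> dS (x, 0) (0, a) (y, 0) = 0 \<and> dS (0, a) (x, 0) (y, 0) = 0) \<and>
    (\<forall>a\<in>A2. \<forall>b\<in>A2. \<forall>c\<in>A2. dS (0, a) (0, b) (0, c) = 0) \<and>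
    (\<forall>a\<in>A2. \<forall>b\<in>A2. \<forall>x\<in>A1.
      dS (0, a) (0, b) (x, 0) = 0 \<and> dS (0, a) (x, 0) (0, b) = 0 \<and> dS (x, 0) (0, a) (0, b) = 0)"
  (is "?L \<longleftrightarrow> ?R")
proof
  assume ?R
  have "dS X Y Z = 0" if XYZ: "X \<in> A1 \<times> A2" "Y \<in> A1 \<times> A2" "Z \<in> A1 \<times> A2" for X Y Z
  proof -
    obtain x a y b z c where
      X: "X = (x, 0) + (0, a)" and Y: "Y = (y, 0) + (0, b)" and Z: "Z = (z, 0) + (0, c)"
      and mem: "x \<in> A1" "y \<in> A1" "z \<in> A1" "a \<in> A2" "b \<in> A2" "c \<in> A2"
      using XYZ by (auto simp: plus_prod_def)
    have memS: "(u, 0) \<in> A1 \<times> A2" "(0, d) \<in> A1 \<times> A2" if "u \<in> A1" "d \<in> A2" for u d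
      using that by auto
    show ?thesis
      using \<open>?R\<close> mem memS XYZ unfolding X Y Z
      by (simp add: S.poisson_defect_add del: add_Pair)
  qed
  then show ?L by blast
qed simp

lemma multiplicative_bicrossed_iff:
  "(\<forall>X\<in>A1 \<times> A2. \<forall>Y\<in>A1 \<times> A2. \<alpha>S (mS X Y) = mS (\<alpha>S X) (\<alpha>S Y)) \<longleftrightarrow>
    (\<forall>x\<in>A1. \<forall>y\<in>A1. \<alpha>1 (m1 x y) = m1 (\<alpha>1 x) (\<alpha>1 y)) \<and>
    (\<forall>a\<in>A2. \<forall>b\<in>A2. \<alpha>2 (m2 a b) = m2 (\<alpha>2 a) (\<alpha>2 b)) \<and>
    (\<forall>x\<in>A1. \<forall>a\<in>A2. \<alpha>2 (\<rho>1 x a) = \<rho>1 (\<alpha>1 x) (\<alpha>2 a) \<and> \<alpha>2 (\<mu>1 x a) = \<mu>1 (\<alpha>1 x) (\<alpha>2 a)) \<and>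
    (\<forall>a\<in>A2. \<forall>x\<in>A1. \<alpha>1 (\<rho>2 a x) = \<rho>2 (\<alpha>2 a) (\<alpha>1 x) \<and> \<alpha>1 (\<mu>2 a x) = \<mu>2 (\<alpha>2 a) (\<alpha>1 x))"
  (is "?L \<longleftrightarrow> ?R")
proof
  assume L: ?L
  have "\<alpha>1 (m1 x y) = m1 (\<alpha>1 x) (\<alpha>1 y)" if "x \<in> A1" "y \<in> A1" for x y
    using L[rule_format, of "(x, 0)" "(y, 0)"] that by (simp add: bicrossed_mult_def)
  moreover have "\<alpha>2 (m2 a b) = m2 (\<alpha>2 a) (\<alpha>2 b)" if "a \<in> A2" "b \<in> A2" for a b
    using L[rule_format, of "(0, a)" "(0, b)"] that by (simp add: bicrossed_mult_def)
  moreover have "\<alpha>1 (\<mu>2 a x) = \<mu>2 (\<alpha>2 a) (\<alpha>1 x)" "\<alpha>2 (\<rho>1 x a) = \<rho>1 (\<alpha>1 x) (\<alpha>2 a)"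
    if "x \<in> A1" "a \<in> A2" for x a
    using L[rule_format, of "(x, 0)" "(0, a)"] that by (simp_all add: bicrossed_mult_def)
  moreover have "\<alpha>1 (\<rho>2 a x) = \<rho>2 (\<alpha>2 a) (\<alpha>1 x)" "\<alpha>2 (\<mu>1 x a) = \<mu>1 (\<alpha>1 x) (\<alpha>2 a)"
    if "x \<in> A1" "a \<in> A2" for x a
    using L[rule_format, of "(0, a)" "(x, 0)"] that by (simp_all add: bicrossed_mult_def)
  ultimately show ?R by blast
qed (auto simp: bicrossed_mult_def)

text \<open>
  The conditions that define a matched pair are exactly the homogeneous components of multiplicativity
  and of the admissible identity for the bicrossed product.
\<close>

theorem admissible_bicrossed_iff_matched_pair:
  "admissible_hom_poisson sS (A1 \<times> A2) mS \<alpha>S \<longleftrightarrow>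
    matched_pair_hom_poisson s1 s2 A1 A2 m1 m2 \<rho>1 \<mu>1 \<rho>2 \<mu>2 \<alpha>1 \<alpha>2"
proof -
  interpret sw: mutual_actions s2 A2 m2 \<alpha>2 s1 A1 m1 \<alpha>1 \<rho>2 \<mu>2 \<rho>1 \<mu>1
    by (rule swapped)
  have swap0: "sw.dS (prod.swap X) (prod.swap Y) (prod.swap Z) = 0 \<longleftrightarrow> dS X Y Z = 0" for X Y Z
    unfolding defect_swap by (cases "dS X Y Z") (auto simp: zero_prod_def)
  have swap0': "sw.dS (a, x) (b, y) (c, z) = 0 \<longleftrightarrow> dS (x, a) (y, b) (z, c) = 0" for a x b y c z
    using swap0[of "(x, a)" "(y, b)" "(z, c)"] by (simp only: swap_simp)
  have "admissible_hom_poisson sS (A1 \<times> A2) mS \<alpha>S \<longleftrightarrow> half_admissible \<and> sw.half_admissible"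
    unfolding admissible_iff_defect defect_bicrossed_iff multiplicative_bicrossed_iff
      half_admissible_def sw.half_admissible_def swap0'
    by (simp only: S.hom_algebra_axioms simp_thms conj_ac)
  then show ?thesis
    unfolding half_admissible_iff sw.half_admissible_iff matched_pair_hom_poisson_def by blast
qed

end

section \<open>Functionals on a finite-dimensional carrier\<close>

lemma dual_space_simps:
  assumes "\<xi> \<in> dual_space s V"
  shows "x \<in> V \<Longrightarrow> y \<in> V \<Longrightarrow> \<xi> (x + y) = \<xi> x + \<xi> y"
    and "x \<in> V \<Longrightarrow> \<xi> (s c x) = c * \<xi> x"
    and "x \<notin> V \<Longrightarrow> \<xi> x = 0"
  using assms by (simp_all add: dual_space_def linear_on_def)

lemma dual_scale_apply: "dual_scale c \<xi> v = c * \<xi> v"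
  by (simp add: dual_scale_def)

lemma dual_spaceI:
  assumes "\<And>x y. x \<in> V \<Longrightarrow> y \<in> V \<Longrightarrow> \<xi> (x + y) = \<xi> x + \<xi> y"
    and "\<And>c x. x \<in> V \<Longrightarrow> \<xi> (s c x) = c * \<xi> x"
    and "\<And>x. x \<notin> V \<Longrightarrow> \<xi> x = 0"
  shows "\<xi> \<in> dual_space s V"
  using assms by (simp add: dual_space_def linear_on_def)

lemma dual_space_eqI:
  assumes "\<xi> \<in> dual_space s V" "\<eta> \<in> dual_space s V" "\<And>x. x \<in> V \<Longrightarrow> \<xi> x = \<eta> x"
  shows "\<xi> = \<eta>"
proof
  fix x show "\<xi> x = \<eta> x"
    using assms(3) dual_space_simps(3)[OF assms(1)] dual_space_simps(3)[OF assms(2)]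
    by (cases "x \<in> V") simp_all
qed

lemma sum_fun_apply:
  fixes h :: "'i \<Rightarrow> 'v \<Rightarrow> 'w::comm_monoid_add"
  shows "(\<Sum>i\<in>I. h i) v = (\<Sum>i\<in>I. h i v)"
  by (induction I rule: infinite_finite_induct) auto

context fd_space
begin

lemma dual_space_neg:
  assumes "\<xi> \<in> dual_space scale V" "x \<in> V"
  shows "\<xi> (- x) = - \<xi> x"
  using dual_space_simps(2)[OF assms, of "- 1"] by (simp add: scale_minus_left)

lemma dual_space_zero: "\<xi> \<in> dual_space scale V \<Longrightarrow> \<xi> 0 = 0"
  using dual_space_simps(2)[of \<xi> scale V 0 0] subspace_0[OF subspace_carrier] by simp

lemma ex_dual_basis:
  "\<exists>B c. finite B \<and> B \<subseteq> V \<and> (\<forall>b\<in>B. c b \<in> dual_space scale V) \<and>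
    (\<forall>v\<in>V. v = (\<Sum>b\<in>B. scale (c b v) b))"
proof -
  obtain B0 where B0: "finite B0" "span B0 = V"
    using finite_dimensional by blast
  obtain B where B: "B \<subseteq> B0" "independent B" "B0 \<subseteq> span B"
    using maximal_independent_subset .
  have span: "span B = V"
    using B B0 span_mono[of B B0] span_mono[of B0 "span B"] by (auto simp: span_span)
  define c where "c b v = (if v \<in> V then representation B v b else 0)" for b v
  have "c b \<in> dual_space scale V" for b
    using span_add[of _ B] span_scale[of _ B]
    by (intro dual_spaceI)
      (auto simp: c_def span representation_add[OF B(2)] representation_scale[OF B(2)])
  moreover have fin: "finite B"
    using B B0 finite_subset by blast
  moreover have "v = (\<Sum>b\<in>B. scale (c b v) b)" if "v \<in> V" for v
    using sum_representation_eq[OF B(2), of v B] that fin by (simp add: c_def span)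
  moreover have "B \<subseteq> V"
    using span_superset[of B] span by simp
  ultimately show ?thesis by blast
qed

lemma dual_space_separates:
  assumes "x \<in> V" "y \<in> V" "\<And>\<xi>. \<xi> \<in> dual_space scale V \<Longrightarrow> \<xi> x = \<xi> y"
  shows "x = y"
proof -
  obtain B c where "finite B" "B \<subseteq> V" and c: "\<And>b. b \<in> B \<Longrightarrow> c b \<in> dual_space scale V"
    and sum: "\<And>v. v \<in> V \<Longrightarrow> v = (\<Sum>b\<in>B. scale (c b v) b)"
    using ex_dual_basis by blast
  have "(\<Sum>b\<in>B. scale (c b x) b) = (\<Sum>b\<in>B. scale (c b y) b)"
    using c assms(3) by (intro sum.cong) auto
  then show ?thesis
    using sum assms(1,2) by metis
qed

lemma linear_functional_sum:
  assumes "linear_on s' (*) W UNIV g" "0 \<in> W" "\<And>x y. x \<in> W \<Longrightarrow> y \<in> W \<Longrightarrow> x + y \<in> W"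
    and "\<And>i. i \<in> I \<Longrightarrow> h i \<in> W" "finite I"
  shows "(\<Sum>i\<in>I. h i) \<in> W \<and> g (\<Sum>i\<in>I. h i) = (\<Sum>i\<in>I. g (h i))"
  using assms(5,4)
proof (induction I rule: finite_induct)
  case empty
  then show ?case
    using assms(2) linear_on_zero[OF assms(1,2)] by simp
next
  case (insert i I)
  then show ?case
    using assms(1,3) by (simp add: linear_on_def)
qed

text \<open>
  Reflexivity of finite-dimensional spaces: expanding a functional in the dual basis \<open>c\<close> of \<open>B\<close> shows
  that \<open>g\<close> is evaluation at \<open>\<Sum>b\<in>B. g(c b) b\<close>.
\<close>

lemma ex_evaluation:
  assumes g: "linear_on dual_scale (*) (dual_space scale V) UNIV g"
  shows "\<exists>p\<in>V. \<forall>\<xi>\<in>dual_space scale V. g \<xi> = \<xi> p"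
proof -
  let ?D = "dual_space scale V"
  obtain B c where fin: "finite B" and BV: "B \<subseteq> V" and c: "\<And>b. b \<in> B \<Longrightarrow> c b \<in> ?D"
    and sum: "\<And>v. v \<in> V \<Longrightarrow> v = (\<Sum>b\<in>B. scale (c b v) b)"
    using ex_dual_basis by blast
  have add: "\<xi> + \<eta> \<in> ?D" and scale: "dual_scale k \<xi> \<in> ?D"
    if "\<xi> \<in> ?D" "\<eta> \<in> ?D" for \<xi> \<eta> k
    using that by (auto intro!: dual_spaceI simp: dual_space_simps dual_scale_apply algebra_simps)
  have zero: "0 \<in> ?D"
    by (auto intro!: dual_spaceI)
  have V: "0 \<in> V" "x \<in> V \<Longrightarrow> y \<in> V \<Longrightarrow> x + y \<in> V" "x \<in> V \<Longrightarrow> scale k x \<in> V" for x y k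
    using subspace_carrier by (auto simp: subspace_def)
  have lin: "linear_on scale (*) V UNIV \<xi>" if "\<xi> \<in> ?D" for \<xi>
    using that by (simp add: dual_space_def)
  have eval: "\<xi> (\<Sum>b\<in>B. scale (k b) b) = (\<Sum>b\<in>B. k b * \<xi> b)" if "\<xi> \<in> ?D" for \<xi> k
    using linear_functional_sum[OF lin[OF that] V(1,2), of B "\<lambda>b. scale (k b) b"]
      V(3) BV fin dual_space_simps(2)[OF that] by (simp add: subset_iff)
  define p where "p = (\<Sum>b\<in>B. scale (g (c b)) b)"
  have "p \<in> V"
    unfolding p_def using BV V(3) by (intro subspace_sum[OF subspace_carrier]) auto
  moreover have "g \<xi> = \<xi> p" if \<xi>: "\<xi> \<in> ?D" for \<xi>
  proof -
    have mem: "(\<Sum>b\<in>B. dual_scale (\<xi> b) (c b)) \<in> ?D"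
      and g_sum: "g (\<Sum>b\<in>B. dual_scale (\<xi> b) (c b)) = (\<Sum>b\<in>B. g (dual_scale (\<xi> b) (c b)))"
      using linear_functional_sum[OF g zero add _ fin, of "\<lambda>b. dual_scale (\<xi> b) (c b)"] scale c
      by blast+
    have "\<xi> = (\<Sum>b\<in>B. dual_scale (\<xi> b) (c b))"
    proof (rule dual_space_eqI[OF \<xi> mem])
      fix v assume "v \<in> V"
      then have "\<xi> v = \<xi> (\<Sum>b\<in>B. scale (c b v) b)"
        using sum by simp
      then show "\<xi> v = (\<Sum>b\<in>B. dual_scale (\<xi> b) (c b)) v"
        by (simp add: eval[OF \<xi>] sum_fun_apply dual_scale_apply mult.commute)
    qed
    then have "g \<xi> = (\<Sum>b\<in>B. g (dual_scale (\<xi> b) (c b)))"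
      using g_sum by simp
    also have "\<dots> = (\<Sum>b\<in>B. g (c b) * \<xi> b)"
      using g c by (intro sum.cong) (auto simp: linear_on_def)
    finally show ?thesis
      by (simp add: p_def eval[OF \<xi>])
  qed
  ultimately show ?thesis by blast
qed

end

section \<open>The star representations and the invariant form\<close>

locale regular_dual_algebras =
  hA: hom_algebra s A m \<alpha> +
  hD: hom_algebra dual_scale "dual_space s A" mD "dual_map A (inv_into A \<alpha>)"
  for s :: "'f::field \<Rightarrow> 'a::ab_group_add \<Rightarrow> 'a" and A m \<alpha> mD +
  assumes regular: "regular_twist A \<alpha>"
    and multiplicative: "\<lbrakk>x \<in> A; y \<in> A\<rbrakk> \<Longrightarrow> \<alpha> (m x y) = m (\<alpha> x) (\<alpha> y)"
    and multiplicative_dual: "\<lbrakk>\<xi> \<in> dual_space s A; \<eta> \<in> dual_space s A\<rbrakk> \<Longrightarrow>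
      dual_map A (inv_into A \<alpha>) (mD \<xi> \<eta>)
        = mD (dual_map A (inv_into A \<alpha>) \<xi>) (dual_map A (inv_into A \<alpha>) \<eta>)"
begin

abbreviation "D \<equiv> dual_space s A"
abbreviation "\<alpha>D \<equiv> dual_map A (inv_into A \<alpha>)"

text \<open>
  The negated maps act as single operators: \<open>uminus_apply\<close> is kept away from the simplifier wherever
  it would break them up before the facts about them apply.
\<close>

abbreviation "\<rho>A \<equiv> - star_rep A \<alpha> (right_mult m)"
abbreviation "\<mu>A \<equiv> - star_rep A \<alpha> (left_mult m)"
abbreviation "\<rho>D \<equiv> - star_rep_dual s A \<alpha> (right_mult mD)"
abbreviation "\<mu>D \<equiv> - star_rep_dual s A \<alpha> (left_mult mD)"

lemmas dual_simps = dual_space_simps[where s = s and V = A] dual_scale_apply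

lemma inv_twist [simp]:
  assumes "x \<in> A"
  shows "inv_into A \<alpha> x \<in> A" "\<alpha> (inv_into A \<alpha> x) = x" "inv_into A \<alpha> (\<alpha> x) = x"
  using assms regular bij_betw_inv_into_right[of \<alpha> A A] bij_betw_inv_into_left[of \<alpha> A A]
    bij_betwE[OF bij_betw_inv_into, of \<alpha> A A]
  unfolding regular_twist_def by auto

lemma dual_twist_apply: "x \<in> A \<Longrightarrow> \<alpha>D \<xi> x = \<xi> (inv_into A \<alpha> x)"
  by (simp add: dual_map_def)

lemma dual_twist_twist [simp]: "x \<in> A \<Longrightarrow> \<alpha>D \<xi> (\<alpha> x) = \<xi> x"
  by (simp add: dual_map_def)

text \<open>
  The adjointness relations below describe a functional by its values at twisted vectors, and a vector
  by its pairings with twisted functionals. Bijectivity of \<open>\<alpha>\<close> makes both descriptions unique.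
\<close>

lemma dual_eq_via_twist:
  assumes "\<xi> \<in> D" "\<eta> \<in> D" "\<And>x. x \<in> A \<Longrightarrow> \<xi> (\<alpha> x) = \<eta> (\<alpha> x)"
  shows "\<xi> = \<eta>"
  using assms(1,2) by (rule dual_space_eqI) (metis assms(3) inv_twist(1,2))

lemma eq_via_dual_twist:
  assumes "x \<in> A" "y \<in> A" "\<And>\<xi>. \<xi> \<in> D \<Longrightarrow> \<alpha>D \<xi> x = \<alpha>D \<xi> y"
  shows "x = y"
proof -
  have "inv_into A \<alpha> x = inv_into A \<alpha> y"
    using assms by (intro hA.dual_space_separates) (auto simp: dual_twist_apply)
  then show ?thesis
    using assms(1,2) inv_twist(2) by metis
qed

lemma minus_star_rep_apply:
  assumes "bilinear_on s s s A A A \<rho>" "x \<in> A"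
  shows "(- star_rep A \<alpha> \<rho>) x \<xi> y = (if y \<in> A then \<alpha>D (\<alpha>D \<xi>) (\<rho> (\<alpha> x) y) else 0)"
  using assms(2) bilinear_on_mem[OF assms(1)]
  by (simp add: star_rep_def dual_rep_def dual_map_def)

lemma bilinear_minus_star_rep:
  assumes \<rho>: "bilinear_on s s s A A A \<rho>"
  shows "bilinear_on s dual_scale dual_scale A D D (- star_rep A \<alpha> \<rho>)"
proof -
  note simps = minus_star_rep_apply[OF \<rho>] dual_simps bilinear_onD[OF \<rho>]
  show ?thesis
    by (rule bilinear_onI) (auto intro!: dual_spaceI ext simp: simps simp del: uminus_apply)
qed

text \<open>
  Multiplicativity turns \<open>\<rho> (\<alpha> x) (\<alpha> y)\<close> into \<open>\<alpha> (\<rho> x y)\<close>, and this \<open>\<alpha>\<close> cancels one of the two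
  inverse twists in \<open>\<rho>\<^sup>\<star>(x)\<xi> = \<rho>\<^sup>*(\<alpha>(x))((\<alpha>\<^sup>-\<^sup>2)\<^sup>*\<xi>)\<close>.
\<close>

lemma minus_star_rep_twist:
  assumes "bilinear_on s s s A A A \<rho>" "\<And>x y. x \<in> A \<Longrightarrow> y \<in> A \<Longrightarrow> \<alpha> (\<rho> x y) = \<rho> (\<alpha> x) (\<alpha> y)"
    and "x \<in> A" "\<xi> \<in> D" "y \<in> A"
  shows "(- star_rep A \<alpha> \<rho>) x \<xi> (\<alpha> y) = \<alpha>D \<xi> (\<rho> x y)"
  using assms(3-) bilinear_on_mem[OF assms(1)] assms(2)[symmetric]
  by (simp add: minus_star_rep_apply[OF assms(1)] del: uminus_apply)

text \<open>
  The functional to which the inverse of the bidual embedding is applied is linear on \<open>A\<^sup>*\<close>, hence an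
  evaluation at a unique vector; that vector is characterised by its pairings.
\<close>

lemma star_rep_dual_eval:
  assumes \<rho>: "bilinear_on dual_scale dual_scale dual_scale D D D \<rho>" and "\<xi> \<in> D" "x \<in> A"
  shows "star_rep_dual s A \<alpha> \<rho> \<xi> x \<in> A \<and>
    (\<forall>\<eta>\<in>D. \<eta> (star_rep_dual s A \<alpha> \<rho> \<xi> x) = - \<rho> (\<alpha>D \<xi>) \<eta> (\<alpha> (\<alpha> x)))"
proof -
  let ?bid = "bidual_embedding s A"
  let ?g = "dual_rep D \<rho> (\<alpha>D \<xi>) (?bid (\<alpha> (\<alpha> x)))"
  have g: "?g \<eta> = (if \<eta> \<in> D then - \<rho> (\<alpha>D \<xi>) \<eta> (\<alpha> (\<alpha> x)) else 0)" for \<eta>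
    using assms(2) bilinear_on_mem[OF \<rho>] by (simp add: dual_rep_def bidual_embedding_def)
  have "linear_on dual_scale (*) D UNIV ?g"
    using assms(2) bilinear_onD[OF \<rho>] unfolding g by (intro linear_onI) (auto simp: dual_scale_apply)
  then obtain p where p: "p \<in> A" "\<And>\<eta>. \<eta> \<in> D \<Longrightarrow> ?g \<eta> = \<eta> p"
    using hA.ex_evaluation by blast
  have "?bid p \<eta> = ?g \<eta>" for \<eta>
  proof -
    have "?bid p \<eta> = (if \<eta> \<in> D then \<eta> p else 0)"
      by (simp add: bidual_embedding_def)
    then show ?thesis
      using p(2)[of \<eta>] g[of \<eta>] by presburger
  qed
  then have "?bid p = ?g" by (rule ext)
  moreover have "inj_on ?bid A"
  proof (rule inj_onI)
    fix u v assume uv: "u \<in> A" "v \<in> A" and eq: "?bid u = ?bid v"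
    have "\<eta> u = \<eta> v" if "\<eta> \<in> D" for \<eta>
      using that fun_cong[OF eq, of \<eta>] by (simp add: bidual_embedding_def)
    with uv show "u = v"
      using hA.dual_space_separates by blast
  qed
  ultimately have "star_rep_dual s A \<alpha> \<rho> \<xi> x = p"
    using p(1) unfolding star_rep_dual_def by (metis inv_into_f_f)
  then show ?thesis
    using p g by auto
qed

lemma minus_star_rep_dual_eval:
  assumes "bilinear_on dual_scale dual_scale dual_scale D D D \<rho>" "\<xi> \<in> D" "x \<in> A"
  shows "(- star_rep_dual s A \<alpha> \<rho>) \<xi> x \<in> A"
    and "\<eta> \<in> D \<Longrightarrow> \<eta> ((- star_rep_dual s A \<alpha> \<rho>) \<xi> x) = \<rho> (\<alpha>D \<xi>) \<eta> (\<alpha> (\<alpha> x))"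
  using star_rep_dual_eval[OF assms]
    hA.dual_space_neg[of \<eta> "star_rep_dual s A \<alpha> \<rho> \<xi> x"] by auto

lemma bilinear_minus_star_rep_dual:
  assumes \<rho>: "bilinear_on dual_scale dual_scale dual_scale D D D \<rho>"
  shows "bilinear_on dual_scale s s D A A (- star_rep_dual s A \<alpha> \<rho>)"
  by (intro bilinear_onI hA.dual_space_separates)
    (simp_all add: dual_simps minus_star_rep_dual_eval[OF \<rho>] bilinear_onD[OF \<rho>] del: uminus_apply)

lemma minus_star_rep_dual_twist:
  assumes \<rho>: "bilinear_on dual_scale dual_scale dual_scale D D D \<rho>"
    and "\<And>\<xi> \<eta>. \<xi> \<in> D \<Longrightarrow> \<eta> \<in> D \<Longrightarrow> \<alpha>D (\<rho> \<xi> \<eta>) = \<rho> (\<alpha>D \<xi>) (\<alpha>D \<eta>)"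
    and "\<xi> \<in> D" "x \<in> A" "\<eta> \<in> D"
  shows "\<alpha>D \<eta> ((- star_rep_dual s A \<alpha> \<rho>) \<xi> x) = \<rho> \<xi> \<eta> (\<alpha> x)"
  using assms(3-) minus_star_rep_dual_eval(2)[OF \<rho>, of \<xi> x "\<alpha>D \<eta>"] assms(2)[symmetric]
  by simp

lemma bilinear_one_sided_mults:
  "bilinear_on s s s A A A (left_mult m)" "bilinear_on s s s A A A (right_mult m)"
  "bilinear_on dual_scale dual_scale dual_scale D D D (left_mult mD)"
  "bilinear_on dual_scale dual_scale dual_scale D D D (right_mult mD)"
  using hA.bilinear hD.bilinear
  by (simp_all add: left_mult_def right_mult_def bilinear_on_def linear_on_def)

text \<open>
  Invariance of \<open>Bd\<close>, applied to homogeneous vectors, forces these equations on the components of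
  the mixed products. By nondegeneracy each of them determines one of the four actions, so they link
  the star representations to invariance in both directions.
\<close>

lemma adjointness:
  assumes "x \<in> A" "y \<in> A" "\<xi> \<in> D" "\<eta> \<in> D"
  shows "\<rho>A x \<xi> (\<alpha> y) = \<alpha>D \<xi> (m y x)" "\<mu>A x \<xi> (\<alpha> y) = \<alpha>D \<xi> (m x y)"
    and "\<alpha>D \<eta> (\<rho>D \<xi> x) = mD \<eta> \<xi> (\<alpha> x)" "\<alpha>D \<eta> (\<mu>D \<xi> x) = mD \<xi> \<eta> (\<alpha> x)"
  using assms minus_star_rep_twist[OF bilinear_one_sided_mults(1), of x \<xi> y]
    minus_star_rep_twist[OF bilinear_one_sided_mults(2), of x \<xi> y]
    minus_star_rep_dual_twist[OF bilinear_one_sided_mults(3), of \<xi> x \<eta>]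
    minus_star_rep_dual_twist[OF bilinear_one_sided_mults(4), of \<xi> x \<eta>]
    multiplicative multiplicative_dual
  by (simp_all add: left_mult_def right_mult_def del: uminus_apply)

sublocale mutual_actions s A m \<alpha> dual_scale D mD \<alpha>D \<rho>A \<mu>A \<rho>D \<mu>D
  by unfold_locales
    (intro bilinear_minus_star_rep bilinear_minus_star_rep_dual bilinear_one_sided_mults)+

lemma invariant_form_bicrossed: "invariant_form (A \<times> D) mS \<alpha>S Bd"
  unfolding invariant_form_def
  by (auto simp: Bd_def bicrossed_mult_def dual_simps adjointness simp del: uminus_apply)

lemma embeddings_bicrossed:
  "hom_algebra_embedding s A m \<alpha> sS (A \<times> D) mS \<alpha>S (\<lambda>x. (x, 0))"
  "hom_algebra_embedding dual_scale D mD \<alpha>D sS (A \<times> D) mS \<alpha>S (\<lambda>\<xi>. (0, \<xi>))"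
  by (simp_all add: hom_algebra_embedding_def linear_on_def inj_on_def bicrossed_mult_def vp.scale_prod
      del: uminus_apply)

text \<open>
  Since \<open>Bd\<close> is nondegenerate and \<open>A\<close> and \<open>A\<^sup>*\<close> are isotropic subalgebras, invariance leaves no choice
  for a mixed product: it moves the brackets so that the pairing of a component of \<open>x \<diamondop> \<xi>\<close> or
  \<open>\<xi> \<diamondop> x\<close> with a test vector becomes a pairing with a product inside \<open>A\<close> or inside \<open>A\<^sup>*\<close>.
\<close>

lemma invariant_product_eq_bicrossed:
  assumes "hom_algebra sS (A \<times> D) mult \<alpha>S"
    and emb1: "hom_algebra_embedding s A m \<alpha> sS (A \<times> D) mult \<alpha>S (\<lambda>x. (x, 0))"
    and emb2: "hom_algebra_embedding dual_scale D mD \<alpha>D sS (A \<times> D) mult \<alpha>S (\<lambda>\<xi>. (0, \<xi>))"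
    and inv: "invariant_form (A \<times> D) mult \<alpha>S Bd"
    and X: "X \<in> A \<times> D" and Y: "Y \<in> A \<times> D"
  shows "mult X Y = mS X Y"
proof -
  interpret M: hom_algebra sS "A \<times> D" mult \<alpha>S by fact
  have mem [simp]: "(x, 0) \<in> A \<times> D" "(0, \<xi>) \<in> A \<times> D" if "x \<in> A" "\<xi> \<in> D" for x \<xi>
    using that by auto
  have AA: "mult (x, 0) (y, 0) = (m x y, 0)" if "x \<in> A" "y \<in> A" for x y
    using emb1 that by (simp add: hom_algebra_embedding_def)
  have DD: "mult (0, \<xi>) (0, \<eta>) = (0, mD \<xi> \<eta>)" if "\<xi> \<in> D" "\<eta> \<in> D" for \<xi> \<eta>
    using emb2 that by (simp add: hom_algebra_embedding_def)
  have B: "Bd (mult U V) (\<alpha>S W) = Bd (\<alpha>S U) (mult V W)"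
    if "U \<in> A \<times> D" "V \<in> A \<times> D" "W \<in> A \<times> D" for U V W
    using inv that unfolding invariant_form_def by blast
  have AD: "mult (x, 0) (0, \<xi>) = (\<mu>D \<xi> x, \<rho>A x \<xi>)" if x: "x \<in> A" and \<xi>: "\<xi> \<in> D" for x \<xi>
  proof -
    obtain p q where pq: "mult (x, 0) (0, \<xi>) = (p, q)" "p \<in> A" "q \<in> D"
      using M.mult_simps(1)[OF mem(1)[OF x \<xi>] mem(2)[OF x \<xi>]] by blast
    \<comment> \<open>The test vector \<open>y\<close> goes in front of \<open>x\<close>, and a test functional \<open>\<eta>\<close> behind \<open>\<xi>\<close>, so that one of
      the two bracketings contains a product inside \<open>A\<close> or inside \<open>A\<^sup>*\<close>.\<close>
    have "q (\<alpha> y) = \<alpha>D \<xi> (m y x)" if y: "y \<in> A" for y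
      using B[of "(y, 0)" "(x, 0)" "(0, \<xi>)"] x y \<xi> pq by (simp add: AA Bd_def hA.dual_space_zero)
    then have "q = \<rho>A x \<xi>"
      using pq x \<xi> by (intro dual_eq_via_twist) (simp_all add: adjointness del: uminus_apply)
    moreover have "\<alpha>D \<eta> p = mD \<xi> \<eta> (\<alpha> x)" if \<eta>: "\<eta> \<in> D" for \<eta>
      using B[of "(x, 0)" "(0, \<xi>)" "(0, \<eta>)"] x \<eta> \<xi> pq by (simp add: DD Bd_def hA.dual_space_zero)
    then have "p = \<mu>D \<xi> x"
      using pq x \<xi> by (intro eq_via_dual_twist) (simp_all add: adjointness del: uminus_apply)
    ultimately show ?thesis using pq by simp
  qed
  have DA: "mult (0, \<xi>) (x, 0) = (\<rho>D \<xi> x, \<mu>A x \<xi>)" if x: "x \<in> A" and \<xi>: "\<xi> \<in> D" for x \<xi>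
  proof -
    obtain p q where pq: "mult (0, \<xi>) (x, 0) = (p, q)" "p \<in> A" "q \<in> D"
      using M.mult_simps(1)[OF mem(2)[OF x \<xi>] mem(1)[OF x \<xi>]] by blast
    have "q (\<alpha> y) = \<alpha>D \<xi> (m x y)" if y: "y \<in> A" for y
      using B[of "(0, \<xi>)" "(x, 0)" "(y, 0)"] x y \<xi> pq by (simp add: AA Bd_def hA.dual_space_zero)
    then have "q = \<mu>A x \<xi>"
      using pq x \<xi> by (intro dual_eq_via_twist) (simp_all add: adjointness del: uminus_apply)
    moreover have "\<alpha>D \<eta> p = mD \<eta> \<xi> (\<alpha> x)" if \<eta>: "\<eta> \<in> D" for \<eta>
      using B[of "(0, \<eta>)" "(0, \<xi>)" "(x, 0)"] x \<eta> \<xi> pq by (simp add: DD Bd_def hA.dual_space_zero)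
    then have "p = \<rho>D \<xi> x"
      using pq x \<xi> by (intro eq_via_dual_twist) (simp_all add: adjointness del: uminus_apply)
    ultimately show ?thesis using pq by simp
  qed
  obtain x \<xi> y \<eta> where XY: "X = (x, 0) + (0, \<xi>)" "Y = (y, 0) + (0, \<eta>)"
    and xy: "x \<in> A" "y \<in> A" "\<xi> \<in> D" "\<eta> \<in> D"
    using X Y by (auto simp: plus_prod_def)
  have "mult X Y = mult (x, 0) (y, 0) + mult (x, 0) (0, \<eta>) + mult (0, \<xi>) (y, 0) + mult (0, \<xi>) (0, \<eta>)"
    using xy X Y unfolding XY by (simp add: algebra_simps del: add_Pair)
  also have "\<dots> = mS X Y"
    unfolding XY using xy
    by (simp add: AA DD AD DA bicrossed_mult_def algebra_simps del: uminus_apply)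
  finally show ?thesis .
qed

end

lemma admissible_hom_poisson_cong:
  assumes "admissible_hom_poisson s A m \<alpha>" and eq: "\<And>x y. x \<in> A \<Longrightarrow> y \<in> A \<Longrightarrow> m x y = m' x y"
  shows "admissible_hom_poisson s A m' \<alpha>"
proof -
  interpret admissible_hom_poisson s A m \<alpha> by fact
  have [simp]: "\<alpha> x \<in> A" "m' x y \<in> A" if "x \<in> A" "y \<in> A" for x y
    using that linear_twist bilinear_on_mem[OF bilinear_mult] eq by (auto simp: linear_on_def)
  have "bilinear_on s s s A A A m'"
    using bilinear_mult eq subspace_carrier
    by (simp add: bilinear_on_def linear_on_def subspace_def)
  moreover have "\<alpha> (m' x y) = m' (\<alpha> x) (\<alpha> y)" if "x \<in> A" "y \<in> A" for x y
    using that multiplicative[OF that] by (simp add: eq)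
  ultimately show ?thesis
    using linear_twist admissible
    by unfold_locales (simp_all add: eq)
qed

theorem proposition4p3:
  fixes s :: "'f::field \<Rightarrow> 'a::ab_group_add \<Rightarrow> 'a"
    and A :: "'a set"
    and multA :: "'a \<Rightarrow> 'a \<Rightarrow> 'a"
    and \<alpha> :: "'a \<Rightarrow> 'a"
    and \<Delta> :: "'a \<Rightarrow> ('a \<Rightarrow> 'f) \<Rightarrow> ('a \<Rightarrow> 'f) \<Rightarrow> 'f"
    and multD :: "('a \<Rightarrow> 'f) \<Rightarrow> ('a \<Rightarrow> 'f) \<Rightarrow> 'a \<Rightarrow> 'f"
  assumes "(3::'f) \<noteq> 0"
    and "admissible_hom_poisson s A multA \<alpha>"
    and "regular_twist A \<alpha>"
    and "linear_on s tensor_scale A (tensor_square s A) \<Delta>"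
    and "\<And>\<xi> \<eta>. \<lbrakk>\<xi> \<in> dual_space s A; \<eta> \<in> dual_space s A\<rbrakk> \<Longrightarrow> multD \<xi> \<eta> = dual_comult A \<Delta> \<xi> \<eta>"
    and "admissible_hom_poisson dual_scale (dual_space s A) multD (dual_map A (inv_into A \<alpha>))"
  shows "standard_manin_triple s A multA \<alpha> multD \<longleftrightarrow>
    matched_pair_hom_poisson s dual_scale A (dual_space s A) multA multD
      (- star_rep A \<alpha> (right_mult multA))
      (- star_rep A \<alpha> (left_mult multA))
      (- star_rep_dual s A \<alpha> (right_mult multD))
      (- star_rep_dual s A \<alpha> (left_mult multD))
      \<alpha> (dual_map A (inv_into A \<alpha>))"
proof -
  interpret regular_dual_algebras s A multA \<alpha> multD
    using assms(2,3,6)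
    by (simp add: regular_dual_algebras_def regular_dual_algebras_axioms_def admissible_iff_defect)
  have "standard_manin_triple s A multA \<alpha> multD \<longleftrightarrow> admissible_hom_poisson sS (A \<times> D) mS \<alpha>S"
  proof
    assume "standard_manin_triple s A multA \<alpha> multD"
    then obtain mult where adm: "admissible_hom_poisson sS (A \<times> D) mult \<alpha>S"
      and emb: "hom_algebra_embedding s A multA \<alpha> sS (A \<times> D) mult \<alpha>S (\<lambda>x. (x, 0))"
        "hom_algebra_embedding dual_scale D multD \<alpha>D sS (A \<times> D) mult \<alpha>S (\<lambda>\<xi>. (0, \<xi>))"
        "invariant_form (A \<times> D) mult \<alpha>S Bd"
      unfolding standard_manin_triple_def Let_def by blast
    have "hom_algebra sS (A \<times> D) mult \<alpha>S"
      using adm by (simp add: admissible_iff_defect)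
    then show "admissible_hom_poisson sS (A \<times> D) mS \<alpha>S"
      using admissible_hom_poisson_cong[OF adm] invariant_product_eq_bicrossed emb by blast
  next
    assume "admissible_hom_poisson sS (A \<times> D) mS \<alpha>S"
    then show "standard_manin_triple s A multA \<alpha> multD"
      unfolding standard_manin_triple_def Let_def
      using embeddings_bicrossed invariant_form_bicrossed by blast
  qed
  then show ?thesis
    by (simp only: admissible_bicrossed_iff_matched_pair)
qed

end
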